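(* Let $n>1$, $\textsf{AP}=\{p\}$, and let $K_n$ and $M_n$ be tree structures as described in the context. Then for every HyperCTL$^*$ sentence $\psi$ over $\{p\}$ with $|\psi|<n$, $K_n\models\psi$ if and only if $M_n\models\psi$.
   Context: HyperCTL$^*$: $\varphi::=\top\mid p[x]\mid\neg\varphi\mid\varphi\wedge\varphi\mid\textsf{X}\varphi\mid\varphi\textsf{U}\varphi\mid\exists x.\varphi$ with path variables $x$; evaluated on a Kripke structure (total transition relation, valuation $V$) at a path assignment $\Pi$ (variables to initial paths), current variable $y$, position $i$: $p[x]$ holds iff $p\in V(\Pi(x)(i))$; $\exists x.\varphi$ holds iff some initial path $\pi$ with $\pi[0,i]=\Pi(y)[0,i]$ gives $\Pi[x\leftarrow\pi],x,i\models\varphi$; Booleans, $\textsf{X}$, $\textsf{U}$ standard. A sentence has all temporal modalities under a quantifier and all variables bound; $K\models\varphi$ iff $\Pi,y,0\models\varphi$ for some $\Pi,y$. $|\psi|$ is the size of $\psi$. Tree structures: nodes form a prefix-closed subset of $\mathbb{N}^*$, root $\varepsilon$ initial, edges only to children; regular = unwinding of a finite Kripke structure. Words over $2^{\{p\}}$: an $n$-block is a word in $\{p\}\emptyset^*$ of length at least $n+2$. For words $w_1,\ldots,w_k$ of common length $\ell$, $\textit{join}(w_1,\ldots,w_k)$ is the word of length $\ell$ with $i$-th letter $w_1(i)\cup\cdots\cup w_k(i)$. The dual $\widetilde w$ of $w$ has the same length and $p\in\widetilde w(i)$ iff $p\notin w(i)$. A tuple $\langle w_1,\ldots,w_n\rangle$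 of words of the same length satisfies the $n$-fractal requirement if for all $k\in[1,n]$, $\textit{join}(w_1,\ldots,w_k)=bl^k_1\cdots bl^k_{m_k}\cdot\{p\}$ with $bl^k_1,\ldots,bl^k_{m_k}$ $n$-blocks, $m_1=n+4$, and for $k<n$, $w_{k+1}$ is obtained from $\textit{join}(w_1,\ldots,w_k)$ by replacing its last symbol with $\emptyset$ and replacing each $n$-block $bl^k_i$ by a sequence of $n+4$ $n$-blocks preceded by a non-empty word in $\emptyset^*$ of length at least $n+2$. $K_n$ is any regular tree structure over $2^{\{p\}}$ such that for some $\ell_n>1$: the root has exactly $n+1$ distinct successors $\eta,\xi_1,\ldots,\xi_n$, with a unique initial path through $\eta$ (denoted $\pi(\eta)$) and through each $\xi_k$ (denoted $\pi(\xi_k)$); there are words $w_0,\ldots,w_n$ of length $\ell_n$ such that the trace of $\pi(\eta)$ is $\emptyset\,w_0\,\{p\}^\omega$, the trace of $\pi(\xi_k)$ is $\emptyset\,w_k\,\emptyset^\omega$ for $k\in[1,n]$, $\langle w_1,\ldots,w_n\rangle$ satisfies the $n$-fractal requirement, and $w_0$ is the dual of $\textit{join}(w_1,\ldots,w_n)$. A main position is a position in $[1,\ell_n]$. Let $i_{\textit{alert}}$ be the third (in increasing order) main position $i$ such that the label of $\pi(\xi_1)(i)$ in $K_n$ is $\{p\}$. $M_n$ is obtained from $K_n$ by replacing the label $\{p\}$ of $\pi(\xi_1)$ at position $i_{\textit{alert}}$ with $\emptyset$.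
   Formalization: In the n-fractal requirement each n-block is replaced in place, by a word of the same length as the block; if only the total lengths had to agree, misaligned words w_2 sharing p-positions with w_1 would make the claim false for large n. *)

theory Defs
  imports Main "HOL-Library.Omega_Words_Fun"
begin

section \<open>Kripke structures\<close>

record ('s, 'a) kripke =
  states :: "'s set"
  init :: 's
  edges :: "('s \<times> 's) set"
  val :: "'s \<Rightarrow> 'a set"

definition kripke_structure :: "'a set \<Rightarrow> ('s, 'a) kripke \<Rightarrow> bool" where
  "kripke_structure AP K \<longleftrightarrow>
     init K \<in> states K \<and>
     edges K \<subseteq> states K \<times> states K \<and>
     (\<forall>s\<in>states K. \<exists>t. (s, t) \<in> edges K) \<and>
     (\<forall>s\<in>states K. val K s \<subseteq> AP)"

definition initial_path :: "('s, 'a) kripke \<Rightarrow> (nat \<Rightarrow> 's) \<Rightarrow> bool" where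
  "initial_path K \<pi> \<longleftrightarrow> \<pi> 0 = init K \<and> (\<forall>i. (\<pi> i, \<pi> (Suc i)) \<in> edges K)"

definition trace :: "('s, 'a) kripke \<Rightarrow> (nat \<Rightarrow> 's) \<Rightarrow> nat \<Rightarrow> 'a set" where
  "trace K \<pi> = val K \<circ> \<pi>"

section \<open>HyperCTL*\<close>

datatype ('a, 'v) hyperctl =
    Tt
  | Atom 'a 'v
  | Neg "('a, 'v) hyperctl"
  | Conj "('a, 'v) hyperctl" "('a, 'v) hyperctl"
  | Next "('a, 'v) hyperctl"
  | Until "('a, 'v) hyperctl" "('a, 'v) hyperctl"
  | Ex 'v "('a, 'v) hyperctl"

primrec sat ::
  "('s, 'a) kripke \<Rightarrow> ('v \<Rightarrow> nat \<Rightarrow> 's) \<Rightarrow> 'v \<Rightarrow> nat \<Rightarrow> ('a, 'v) hyperctl \<Rightarrow> bool" where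
  "sat K \<Pi> y i Tt \<longleftrightarrow> True"
| "sat K \<Pi> y i (Atom p x) \<longleftrightarrow> p \<in> val K (\<Pi> x i)"
| "sat K \<Pi> y i (Neg \<phi>) \<longleftrightarrow> \<not> sat K \<Pi> y i \<phi>"
| "sat K \<Pi> y i (Conj \<phi> \<psi>) \<longleftrightarrow> sat K \<Pi> y i \<phi> \<and> sat K \<Pi> y i \<psi>"
| "sat K \<Pi> y i (Next \<phi>) \<longleftrightarrow> sat K \<Pi> y (Suc i) \<phi>"
| "sat K \<Pi> y i (Until \<phi> \<psi>) \<longleftrightarrow>
     (\<exists>j\<ge>i. sat K \<Pi> y j \<psi> \<and> (\<forall>k. i \<le> k \<and> k < j \<longrightarrow> sat K \<Pi> y k \<phi>))"
| "sat K \<Pi> y i (Ex x \<phi>) \<longleftrightarrow>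
     (\<exists>\<pi>. initial_path K \<pi> \<and> (\<forall>j\<le>i. \<pi> j = \<Pi> y j) \<and> sat K (\<Pi>(x := \<pi>)) x i \<phi>)"

primrec props :: "('a, 'v) hyperctl \<Rightarrow> 'a set" where
  "props Tt = {}"
| "props (Atom p x) = {p}"
| "props (Neg \<phi>) = props \<phi>"
| "props (Conj \<phi> \<psi>) = props \<phi> \<union> props \<psi>"
| "props (Next \<phi>) = props \<phi>"
| "props (Until \<phi> \<psi>) = props \<phi> \<union> props \<psi>"
| "props (Ex x \<phi>) = props \<phi>"

primrec free_vars :: "('a, 'v) hyperctl \<Rightarrow> 'v set" where
  "free_vars Tt = {}"
| "free_vars (Atom p x) = {x}"
| "free_vars (Neg \<phi>) = free_vars \<phi>"
| "free_vars (Conj \<phi> \<psi>) = free_vars \<phi> \<union> free_vars \<psi>"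
| "free_vars (Next \<phi>) = free_vars \<phi>"
| "free_vars (Until \<phi> \<psi>) = free_vars \<phi> \<union> free_vars \<psi>"
| "free_vars (Ex x \<phi>) = free_vars \<phi> - {x}"

text \<open>Every temporal modality lies in the scope of a path quantifier.\<close>

primrec modalities_guarded :: "('a, 'v) hyperctl \<Rightarrow> bool" where
  "modalities_guarded Tt \<longleftrightarrow> True"
| "modalities_guarded (Atom p x) \<longleftrightarrow> True"
| "modalities_guarded (Neg \<phi>) \<longleftrightarrow> modalities_guarded \<phi>"
| "modalities_guarded (Conj \<phi> \<psi>) \<longleftrightarrow> modalities_guarded \<phi> \<and> modalities_guarded \<psi>"
| "modalities_guarded (Next \<phi>) \<longleftrightarrow> False"
| "modalities_guarded (Until \<phi> \<psi>) \<longleftrightarrow> False"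
| "modalities_guarded (Ex x \<phi>) \<longleftrightarrow> True"

definition sentence :: "('a, 'v) hyperctl \<Rightarrow> bool" where
  "sentence \<phi> \<longleftrightarrow> modalities_guarded \<phi> \<and> free_vars \<phi> = {}"

text \<open>Number of nodes of the syntax tree (the datatype's own \<open>size\<close> counts leaves as 0).\<close>

primrec fsize :: "('a, 'v) hyperctl \<Rightarrow> nat" where
  "fsize Tt = 1"
| "fsize (Atom p x) = 1"
| "fsize (Neg \<phi>) = 1 + fsize \<phi>"
| "fsize (Conj \<phi> \<psi>) = 1 + fsize \<phi> + fsize \<psi>"
| "fsize (Next \<phi>) = 1 + fsize \<phi>"
| "fsize (Until \<phi> \<psi>) = 1 + fsize \<phi> + fsize \<psi>"
| "fsize (Ex x \<phi>) = 1 + fsize \<phi>"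

definition models :: "('s, 'a) kripke \<Rightarrow> ('a, 'v) hyperctl \<Rightarrow> bool"  (infix "\<Turnstile>" 50) where
  "K \<Turnstile> \<phi> \<longleftrightarrow> (\<exists>\<Pi> y. (\<forall>x. initial_path K (\<Pi> x)) \<and> sat K \<Pi> y 0 \<phi>)"

section \<open>Regular tree structures\<close>

definition tree_structure :: "'a set \<Rightarrow> (nat list, 'a) kripke \<Rightarrow> bool" where
  "tree_structure AP K \<longleftrightarrow>
     kripke_structure AP K \<and>
     (\<forall>u v. u @ v \<in> states K \<longrightarrow> u \<in> states K) \<and>
     init K = [] \<and>
     (\<forall>u v. (u, v) \<in> edges K \<longrightarrow> (\<exists>i. v = u @ [i]))"

text \<open>The states of the unwinding are the finite initial paths, as non-empty lists of states.\<close>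

definition unwinding :: "('s, 'a) kripke \<Rightarrow> ('s list, 'a) kripke" where
  "unwinding F =
     (let S = {\<rho>. \<rho> \<noteq> [] \<and> hd \<rho> = init F \<and>
                  (\<forall>i. Suc i < length \<rho> \<longrightarrow> (\<rho> ! i, \<rho> ! Suc i) \<in> edges F)}
      in \<lparr>states = S, init = [init F],
          edges = {(\<rho>, \<rho> @ [s]) | \<rho> s. \<rho> \<in> S \<and> \<rho> @ [s] \<in> S},
          val = (\<lambda>\<rho>. val F (last \<rho>))\<rparr>)"

definition kripke_iso :: "('s, 'a) kripke \<Rightarrow> ('t, 'a) kripke \<Rightarrow> bool" where
  "kripke_iso K L \<longleftrightarrow>
     (\<exists>f. bij_betw f (states K) (states L) \<and> f (init K) = init L \<and>
          (\<forall>s\<in>states K. \<forall>t\<in>states K. (s, t) \<in> edges K \<longleftrightarrow> (f s, f t) \<in> edges L) \<and>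
          (\<forall>s\<in>states K. val L (f s) = val K s))"

text \<open>
  Nodes of a tree are sequences of naturals, so being the unwinding of a finite structure is
  meant up to isomorphism. As that structure is finite, its states may be taken to be naturals.
\<close>

definition regular_tree :: "'a set \<Rightarrow> (nat list, 'a) kripke \<Rightarrow> bool" where
  "regular_tree AP K \<longleftrightarrow>
     tree_structure AP K \<and>
     (\<exists>F :: (nat, 'a) kripke. kripke_structure AP F \<and> finite (states F) \<and>
        kripke_iso K (unwinding F))"

section \<open>Words and the fractal requirement\<close>

definition n_block :: "'a \<Rightarrow> nat \<Rightarrow> 'a set list \<Rightarrow> bool" where
  "n_block p n u \<longleftrightarrow> (\<exists>m. u = {p} # replicate m {}) \<and> length u \<ge> n + 2"

definition join :: "'a set list list \<Rightarrow> 'a set list" where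
  "join ws = map (\<lambda>i. \<Union>w\<in>set ws. w ! i) [0..<length (hd ws)]"

definition dual :: "'a \<Rightarrow> 'a set list \<Rightarrow> 'a set list" where
  "dual p w = map (\<lambda>a. {p} - a) w"

definition block_expansion :: "'a \<Rightarrow> nat \<Rightarrow> 'a set list \<Rightarrow> bool" where
  "block_expansion p n u \<longleftrightarrow>
     (\<exists>g bs. u = replicate g {} @ concat bs \<and> g \<ge> n + 2 \<and>
             length bs = n + 4 \<and> (\<forall>b\<in>set bs. n_block p n b))"

text \<open>
  \<open>bl k\<close> is the list of \<open>n\<close>-blocks of the join of the first \<open>k\<close> words. Blocks are replaced in
  place, i.e. by words of the same length: the words are compared position by position, and
  equality of the total lengths alone would not keep a replacement inside its block.
\<close>

definition fractal :: "'a \<Rightarrow> nat \<Rightarrow> (nat \<Rightarrow> 'a set list) \<Rightarrow> bool" where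
  "fractal p n w \<longleftrightarrow>
     (\<forall>j\<in>{1..n}. \<forall>k\<in>{1..n}. length (w j) = length (w k)) \<and>
     (\<exists>bl. length (bl 1) = n + 4 \<and>
        (\<forall>k\<in>{1..n}.
           (\<forall>b\<in>set (bl k). n_block p n b) \<and>
           join (map w [1..<Suc k]) = concat (bl k) @ [{p}] \<and>
           (k < n \<longrightarrow>
              (\<exists>us. list_all2 (\<lambda>b u. length u = length b \<and> block_expansion p n u) (bl k) us \<and>
                    w (Suc k) = concat us @ [{}]))))"

section \<open>The structures \<open>K\<^sub>n\<close> and \<open>M\<^sub>n\<close>\<close>

definition path_through :: "('s, 'a) kripke \<Rightarrow> 's \<Rightarrow> nat \<Rightarrow> 's" where
  "path_through K s = (THE \<pi>. initial_path K \<pi> \<and> s \<in> range \<pi>)"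

definition is_K ::
  "'a \<Rightarrow> nat \<Rightarrow> nat \<Rightarrow> nat list \<Rightarrow> (nat \<Rightarrow> nat list) \<Rightarrow> (nat \<Rightarrow> 'a set list) \<Rightarrow>
   (nat list, 'a) kripke \<Rightarrow> bool" where
  "is_K p n l \<eta> \<xi> w K \<longleftrightarrow>
     regular_tree {p} K \<and> l > 1 \<and>
     {s. (init K, s) \<in> edges K} = insert \<eta> (\<xi> ` {1..n}) \<and>
     inj_on \<xi> {1..n} \<and> \<eta> \<notin> \<xi> ` {1..n} \<and>
     (\<exists>!\<pi>. initial_path K \<pi> \<and> \<eta> \<in> range \<pi>) \<and>
     (\<forall>k\<in>{1..n}. \<exists>!\<pi>. initial_path K \<pi> \<and> \<xi> k \<in> range \<pi>) \<and>
     (\<forall>k\<in>{0..n}. length (w k) = l \<and> set (w k) \<subseteq> Pow {p}) \<and>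
     trace K (path_through K \<eta>) = ({} # w 0) \<frown> [{p}]\<^sup>\<omega> \<and>
     (\<forall>k\<in>{1..n}. trace K (path_through K (\<xi> k)) = ({} # w k) \<frown> [{}]\<^sup>\<omega>) \<and>
     fractal p n w \<and>
     w 0 = dual p (join (map w [1..<Suc n]))"

text \<open>Third element, in increasing order, of the set of main positions labelled \<open>{p}\<close>.\<close>

definition i_alert :: "'a \<Rightarrow> nat \<Rightarrow> (nat \<Rightarrow> nat list) \<Rightarrow> (nat list, 'a) kripke \<Rightarrow> nat" where
  "i_alert p l \<xi> K =
     sorted_list_of_set {i \<in> {1..l}. val K (path_through K (\<xi> 1) i) = {p}} ! 2"

definition M_of ::
  "'a \<Rightarrow> nat \<Rightarrow> (nat \<Rightarrow> nat list) \<Rightarrow> (nat list, 'a) kripke \<Rightarrow> (nat list, 'a) kripke" where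
  "M_of p l \<xi> K = K\<lparr>val := (val K)(path_through K (\<xi> 1) (i_alert p l \<xi> K) := {})\<rparr>"

end

theory Submission
  imports Defs
begin

text \<open>
  The \<open>n + 1\<close> initial paths separate right after the root, so quantifiers have a choice at position 0
  only, and a sentence of size less than \<open>n\<close> refers to fewer than \<open>n\<close> paths at a time. Hence some path
  \<open>h\<close> other than \<open>\<pi>(\<xi>\<^sub>1)\<close> is never looked at. In \<open>K\<^sub>n\<close> every positive position carries \<open>p\<close> on exactly
  one path, which turns the structure into a word over path indices; as \<open>h\<close> is not observed, erasing \<open>p\<close>
  at the alert position amounts to replacing a letter 1 by the letter \<open>h\<close>. In the fractal word this
  replacement joins two segments of level below \<open>h\<close>, which changes only the number of repetitions of
  mutually indistinguishable factors, and all these numbers are at least \<open>n\<close>. A formula of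
  size at most \<open>m\<close> does not distinguish \<open>m\<close> from \<open>m + 1\<close> repetitions of a factor.
\<close>

section \<open>Pumping\<close>

text \<open>From position 1 on the only path extending a prefix of the current path is that path itself, so
  a quantifier merely copies the current path. In \<open>wsat \<rho> y x \<phi>\<close> a path is given by its index, and a
  letter of \<open>x\<close> is the index of the one path that carries the proposition there.\<close>

primrec wsat :: "('v \<Rightarrow> 'l) \<Rightarrow> 'v \<Rightarrow> 'l word \<Rightarrow> ('a, 'v) hyperctl \<Rightarrow> bool" where
  "wsat \<rho> y x Tt \<longleftrightarrow> True"
| "wsat \<rho> y x (Atom p z) \<longleftrightarrow> x 0 = \<rho> z"
| "wsat \<rho> y x (Neg \<phi>) \<longleftrightarrow> \<not> wsat \<rho> y x \<phi>"
| "wsat \<rho> y x (Conj \<phi> \<psi>) \<longleftrightarrow> wsat \<rho> y x \<phi> \<and> wsat \<rho> y x \<psi>"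
| "wsat \<rho> y x (Next \<phi>) \<longleftrightarrow> wsat \<rho> y (suffix 1 x) \<phi>"
| "wsat \<rho> y x (Until \<phi> \<psi>) \<longleftrightarrow>
     (\<exists>j. wsat \<rho> y (suffix j x) \<psi> \<and> (\<forall>k<j. wsat \<rho> y (suffix k x) \<phi>))"
| "wsat \<rho> y x (Ex z \<phi>) \<longleftrightarrow> wsat (\<rho>(z := \<rho> y)) z x \<phi>"

lemma fsize_pos: "0 < fsize \<phi>"
  by (cases \<phi>) auto

text \<open>The primed sequences have \<open>c\<close> further entries: below \<open>t\<close> they
  agree with the unprimed ones, later they lag behind by \<open>c\<close>. A witness below
  \<open>t\<close> is kept and any other is moved by \<open>c\<close>; since
  \<open>c \<le> t\<close>, the indices from \<open>t - c\<close> to \<open>t\<close> are covered by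
  both rules.\<close>

lemma until_shift:
  fixes A B A' B' :: "nat \<Rightarrow> bool"
  assumes "\<And>k. k < t \<Longrightarrow> A' k = A k" "\<And>k. k < t \<Longrightarrow> B' k = B k"
    and "\<And>k. t \<le> k + c \<Longrightarrow> A' (k + c) = A k" "\<And>k. t \<le> k + c \<Longrightarrow> B' (k + c) = B k"
    and "c \<le> t"
  shows "(\<exists>j. B j \<and> (\<forall>k<j. A k)) \<longleftrightarrow> (\<exists>j. B' j \<and> (\<forall>k<j. A' k))"
proof
  assume "\<exists>j. B j \<and> (\<forall>k<j. A k)"
  then obtain j where j: "B j" "\<And>k. k < j \<Longrightarrow> A k" by blast
  show "\<exists>j. B' j \<and> (\<forall>k<j. A' k)"
  proof (cases "j < t")
    case True
    with j assms(1,2) show ?thesis by (metis order.strict_trans)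
  next
    case False
    have "A' k" if "k < j + c" for k
    proof (cases "k < t")
      case True
      with False j(2) assms(1) show ?thesis by simp
    next
      case nt: False
      then have "k - c < j" "t \<le> (k - c) + c" "(k - c) + c = k" using that assms(5) by linarith+
      with j(2) assms(3) show ?thesis by metis
    qed
    moreover have "B' (j + c)" using assms(4)[of j] j(1) False by simp
    ultimately show ?thesis by blast
  qed
next
  assume "\<exists>j. B' j \<and> (\<forall>k<j. A' k)"
  then obtain j where j: "B' j" "\<And>k. k < j \<Longrightarrow> A' k" by blast
  show "\<exists>j. B j \<and> (\<forall>k<j. A k)"
  proof (cases "j < t")
    case True
    with j assms(1,2) show ?thesis by (metis order.strict_trans)
  next
    case False
    then have jc: "t \<le> (j - c) + c" "(j - c) + c = j" using assms(5) by linarith+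
    have "A k" if "k < j - c" for k
    proof (cases "k < t")
      case True
      with that j(2)[of k] assms(1)[of k] show ?thesis by simp
    next
      case nt: False
      then have "t \<le> k + c" "k + c < j" using that by linarith+
      with j(2) assms(3) show ?thesis by metis
    qed
    moreover have "B (j - c)" using assms(4)[of "j - c"] j(1) jc by simp
    ultimately show ?thesis by blast
  qed
qed

text \<open>Induction on \<open>\<phi>\<close> with arbitrary prefix \<open>s\<close>. A temporal
  operator passes to a smaller formula and to a suffix that starts inside \<open>s @ u\<close>, at
  the cost of one copy of \<open>u\<close>, or later, where both words have the same suffixes. The
  size bound thus leaves at least one copy for an atom to see.\<close>

lemma wsat_pump:
  assumes "fsize \<phi> \<le> m"
  shows "wsat \<rho> y (s \<frown> concat (replicate m u) \<frown> x) \<phi> \<longleftrightarrow>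
         wsat \<rho> y (s \<frown> concat (replicate (Suc m) u) \<frown> x) \<phi>"
  using assms
proof (induction \<phi> arbitrary: \<rho> y s m)
  case (Atom p z)
  then obtain m' where m: "m = Suc m'" by (cases m) auto
  show ?case by (auto simp: m conc_def nth_append)
next
  case (Next \<phi>)
  then obtain m' where m: "m = Suc m'" and le: "fsize \<phi> \<le> m'" by (cases m) auto
  show ?case
  proof (cases "s @ u = []")
    case False
    then have 1: "1 \<le> length (s @ u)" by (cases "s @ u") auto
    \<comment> \<open>One copy of \<open>u\<close> is absorbed into the prefix even if
      \<open>s\<close> is non-empty, which covers the case of empty \<open>s\<close> as
      well.\<close>
    have eq: "suffix 1 (s \<frown> concat (replicate (Suc k) u) \<frown> x) = drop 1 (s @ u) \<frown> concat (replicate k u) \<frown> x" for k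
      using suffix_conc_fst[OF 1, of "concat (replicate k u) \<frown> x"] by simp
    show ?thesis unfolding m wsat.simps eq by (rule Next.IH[OF le])
  qed simp
next
  case (Until \<phi> \<psi>)
  then obtain m' where m: "m = Suc m'" and le: "fsize \<phi> \<le> m'" "fsize \<psi> \<le> m'" by (cases m) auto
  let ?W = "s \<frown> concat (replicate m u) \<frown> x" and ?W' = "s \<frown> concat (replicate (Suc m) u) \<frown> x"
  have pre: "suffix j (s \<frown> concat (replicate (Suc k) u) \<frown> x) = drop j (s @ u) \<frown> concat (replicate k u) \<frown> x"
    if "j < length (s @ u)" for j k
    using suffix_conc_fst[of j "s @ u" "concat (replicate k u) \<frown> x"] that by simp
  have suf: "suffix (k + length u) ?W' = suffix k ?W" if "length (s @ u) \<le> k + length u" for k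
  proof -
    have "suffix (k + length u) ((s @ u) \<frown> concat (replicate m u) \<frown> x) = suffix k ?W"
      using that suffix_conc_snd[of "s @ u" "k + length u" "concat (replicate m u) \<frown> x"]
        suffix_conc_snd[of s k "concat (replicate m u) \<frown> x"]
      by (simp del: suffix_conc_snd)
    then show ?thesis by simp
  qed
  show ?case unfolding wsat.simps
  \<comment> \<open>Suffixes starting in \<open>s\<close> or in the first copy fall under the
    induction hypothesis with one copy less; later suffixes of \<open>?W'\<close> are suffixes of
    \<open>?W\<close> displaced by one copy.\<close>
  proof (rule until_shift[where t = "length (s @ u)" and c = "length u"])
    fix k assume k: "k < length (s @ u)"
    show "wsat \<rho> y (suffix k ?W') \<phi> = wsat \<rho> y (suffix k ?W) \<phi>"
      unfolding m pre[OF k] by (rule Until.IH(1)[OF le(1), symmetric])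
    show "wsat \<rho> y (suffix k ?W') \<psi> = wsat \<rho> y (suffix k ?W) \<psi>"
      unfolding m pre[OF k] by (rule Until.IH(2)[OF le(2), symmetric])
  qed (simp_all only: suf length_append le_add2)
next
  case (Neg \<phi>)
  then show ?case using Neg.IH[of m \<rho> y s] by simp
next
  case (Conj \<phi> \<psi>)
  then show ?case using Conj.IH(1)[of m \<rho> y s] Conj.IH(2)[of m \<rho> y s] by simp
next
  case (Ex z \<phi>)
  then show ?case unfolding wsat.simps by (intro Ex.IH) simp
qed simp

text \<open>Quantifying over both contexts \<open>s\<close> and \<open>x\<close> makes this a
  congruence for concatenation, so that factors can be exchanged deep inside a word.\<close>

definition ctx_equiv :: "('a, 'v) hyperctl set \<Rightarrow> 'l list \<Rightarrow> 'l list \<Rightarrow> bool" where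
  "ctx_equiv F u v \<longleftrightarrow>
     (\<forall>\<phi>\<in>F. \<forall>s x \<rho> y. wsat \<rho> y (s \<frown> u \<frown> x) \<phi> \<longleftrightarrow> wsat \<rho> y (s \<frown> v \<frown> x) \<phi>)"

lemma ctx_equiv_refl [simp]: "ctx_equiv F u u"
  by (simp add: ctx_equiv_def)

lemma ctx_equiv_sym: "ctx_equiv F u v \<Longrightarrow> ctx_equiv F v u"
  by (simp add: ctx_equiv_def)

lemma ctx_equiv_trans: "ctx_equiv F u v \<Longrightarrow> ctx_equiv F v w \<Longrightarrow> ctx_equiv F u w"
  by (simp add: ctx_equiv_def)

lemma ctx_equiv_append:
  assumes "ctx_equiv F u u'" "ctx_equiv F v v'"
  shows "ctx_equiv F (u @ v) (u' @ v')"
proof -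
  have "wsat \<rho> y (s \<frown> (u @ v) \<frown> x) \<phi> = wsat \<rho> y (s \<frown> (u' @ v') \<frown> x) \<phi>" if "\<phi> \<in> F" for \<phi> s x \<rho> y
  proof -
    have "wsat \<rho> y (s \<frown> u \<frown> (v \<frown> x)) \<phi> = wsat \<rho> y (s \<frown> u' \<frown> (v \<frown> x)) \<phi>"
      using assms(1) that unfolding ctx_equiv_def by blast
    also have "\<dots> = wsat \<rho> y ((s @ u') \<frown> v \<frown> x) \<phi>" by simp
    also have "\<dots> = wsat \<rho> y ((s @ u') \<frown> v' \<frown> x) \<phi>"
      using assms(2) that unfolding ctx_equiv_def by blast
    finally show ?thesis by simp
  qed
  then show ?thesis unfolding ctx_equiv_def by blast
qed

lemma ctx_equiv_Cons: "ctx_equiv F u v \<Longrightarrow> ctx_equiv F (a # u) (a # v)"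
  using ctx_equiv_append[of F "[a]" "[a]" u v] by simp

lemma ctx_equiv_concat_replicate:
  "(\<And>u. u \<in> set us \<Longrightarrow> ctx_equiv F u v) \<Longrightarrow>
     ctx_equiv F (concat us) (concat (replicate (length us) v))"
  by (induction us) (auto intro!: ctx_equiv_append)

lemma ctx_equiv_pump:
  assumes "\<forall>\<phi>\<in>F. fsize \<phi> \<le> d" "d \<le> m" "m \<le> m'"
  shows "ctx_equiv F (concat (replicate m u)) (concat (replicate m' u))"
  using assms(3)
proof (induction rule: dec_induct)
  case (step k)
  have "ctx_equiv F (concat (replicate k u)) (concat (replicate (Suc k) u))"
    unfolding ctx_equiv_def using assms(1,2) step.hyps by (intro ballI allI wsat_pump) force
  with step.IH show ?case by (rule ctx_equiv_trans)
qed simp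

text \<open>Both sides are rewritten to powers of the representative \<open>v\<close>, whose
  exponents are too large to be told apart. Pumping thus applies to factors that are merely
  equivalent.\<close>

lemma ctx_equiv_concat:
  assumes F: "\<forall>\<phi>\<in>F. fsize \<phi> \<le> d"
    and "\<And>u. u \<in> set us \<Longrightarrow> ctx_equiv F u v" "d \<le> length us"
    and "\<And>u. u \<in> set us' \<Longrightarrow> ctx_equiv F u v" "d \<le> length us'"
  shows "ctx_equiv F (concat us) (concat us')"
proof -
  have "ctx_equiv F (concat (replicate (length us) v)) (concat (replicate (length us') v))"
    using ctx_equiv_pump[OF F assms(3)] ctx_equiv_sym[OF ctx_equiv_pump[OF F assms(5)]]
    by (meson nat_le_linear)
  then show ?thesis
    using ctx_equiv_concat_replicate[of us F v] ctx_equiv_concat_replicate[of us' F v] assms(2,4)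
    by (meson ctx_equiv_trans ctx_equiv_sym)
qed

text \<open>The words over path indices found between two consecutive letters from \<open>{1..k}\<close>.\<close>

inductive seg :: "nat \<Rightarrow> nat \<Rightarrow> nat list \<Rightarrow> bool" for n where
  seg_base: "n < g \<Longrightarrow> seg n n (replicate g 0)"
| seg_step: "k < n \<Longrightarrow> seg n (Suc k) u0 \<Longrightarrow> length us = n + 4 \<Longrightarrow> \<forall>u\<in>set us. seg n (Suc k) u \<Longrightarrow>
    seg n k (u0 @ concat (map ((#) (Suc k)) us))"

text \<open>At level \<open>n\<close> both words are runs of more than \<open>n\<close> zeros.
  Below, both consist of an initial segment and \<open>n + 4\<close> factors, all equivalent by the
  induction hypothesis for the next level.\<close>

lemma seg_equiv:
  assumes F: "\<forall>\<phi>\<in>F. fsize \<phi> \<le> n" and "seg n k u" "seg n k v"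
  shows "ctx_equiv F u v"
  using assms(2-)
proof (induction arbitrary: v)
  case (seg_base g)
  from seg_base(2) obtain g' where g': "v = replicate g' 0" "n < g'"
    by cases auto
  have r: "replicate k (0::nat) = concat (replicate k [0])" for k by (induction k) auto
  show ?case unfolding g'(1) r using seg_base(1) g'(2)
    by (intro ctx_equiv_concat[OF F, where v = "[0]"]) auto
next
  case (seg_step k u0 us)
  from seg_step.prems obtain v0 vs where v: "v = v0 @ concat (map ((#) (Suc k)) vs)"
    "seg n (Suc k) v0" "length vs = n + 4" "\<forall>u\<in>set vs. seg n (Suc k) u"
    using seg_step.hyps(1) by cases auto
  have "ctx_equiv F (concat (map ((#) (Suc k)) us)) (concat (map ((#) (Suc k)) vs))"
  \<comment> \<open>The initial segment \<open>u0\<close> has level \<open>Suc k\<close> like the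
    members of \<open>us\<close> and \<open>vs\<close>, so it can serve as the common
    representative.\<close>
  proof (rule ctx_equiv_concat[OF F, where v = "Suc k # u0"])
    fix u assume "u \<in> set (map ((#) (Suc k)) us)"
    then show "ctx_equiv F u (Suc k # u0)"
      using seg_step.IH seg_step.hyps(2) by (auto intro!: ctx_equiv_Cons)
  next
    fix u assume "u \<in> set (map ((#) (Suc k)) vs)"
    then show "ctx_equiv F u (Suc k # u0)"
      using seg_step.IH v by (auto intro!: ctx_equiv_Cons ctx_equiv_sym[of _ u0])
  qed (use seg_step v in auto)
  then show ?case unfolding v(1) using seg_step v by (auto intro!: ctx_equiv_append)
qed

text \<open>A letter \<open>h > k\<close> between two segments only increases numbers of repetitions that are already
  too large to be counted; \<open>h = 0\<close> only lengthens a gap.\<close>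

lemma seg_merge:
  assumes F: "\<forall>\<phi>\<in>F. fsize \<phi> \<le> n" and "seg n k u" "seg n k v" "h = 0 \<or> k < h \<and> h \<le> n"
  shows "ctx_equiv F (u @ h # v) u"
  using assms(2-)
proof (induction arbitrary: v)
  case (seg_base g)
  then have h: "h = 0" by auto
  from seg_base(2) obtain g' where g': "v = replicate g' 0" "n < g'"
    by cases auto
  have "replicate g 0 @ h # v = replicate (g + Suc g') 0"
    by (simp add: h g' replicate_add replicate_app_Cons_same)
  then show ?case
    using seg_equiv[OF F seg.seg_base seg.seg_base, of "g + Suc g'" g] seg_base by simp
next
  case (seg_step k u0 us)
  from seg_step.prems(1) obtain v0 vs where v: "v = v0 @ concat (map ((#) (Suc k)) vs)"
    "seg n (Suc k) v0" "length vs = n + 4" "\<forall>u\<in>set vs. seg n (Suc k) u"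
    using seg_step.hyps(1) by cases auto
  let ?c = "\<lambda>us. concat (map ((#) (Suc k)) us)"
  have many: "ctx_equiv F (?c xs) (?c us)"
    if "n \<le> length xs" "\<And>u. u \<in> set xs \<Longrightarrow> seg n (Suc k) u" for xs
  proof (rule ctx_equiv_concat[OF F, where v = "Suc k # u0"])
    fix u assume "u \<in> set (map ((#) (Suc k)) xs)"
    then show "ctx_equiv F u (Suc k # u0)"
      using seg_step.hyps that by (auto intro!: ctx_equiv_Cons seg_equiv[OF F])
  next
    fix u assume "u \<in> set (map ((#) (Suc k)) us)"
    then show "ctx_equiv F u (Suc k # u0)"
      using seg_step by (auto intro!: ctx_equiv_Cons seg_equiv[OF F])
  qed (use seg_step that in auto)
  show ?case
  proof (cases "h = Suc k")
    case True
    \<comment> \<open>The letter \<open>h\<close> acts as a separator of this level: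
      \<open>v0\<close> becomes one more body between those of \<open>us\<close> and
      \<open>vs\<close>.\<close>
    have 1: "(u0 @ ?c us) @ h # v = u0 @ ?c (us @ v0 # vs)" by (simp add: v True)
    have 2: "ctx_equiv F (?c (us @ v0 # vs)) (?c us)" using seg_step v by (intro many) auto
    show ?thesis unfolding 1 by (rule ctx_equiv_append[OF ctx_equiv_refl 2])
  next
    case False
    then have h: "h = 0 \<or> Suc k < h \<and> h \<le> n" using seg_step.prems by auto
    have "us \<noteq> []" using seg_step by auto
    then obtain us' ul where us: "us = us' @ [ul]" by (meson rev_exhaust)
    \<comment> \<open>Here \<open>h\<close> is 0 or belongs to a deeper level, so it fuses the last
      body of \<open>u\<close> with the initial segment of \<open>v\<close>; the induction
      hypothesis removes \<open>h # v0\<close>.\<close>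
    have 1: "(u0 @ ?c us) @ h # v = u0 @ ?c us' @ (Suc k # (ul @ h # v0)) @ ?c vs" by (simp add: v us)
    have "ctx_equiv F (ul @ h # v0) ul" using seg_step us v(2) h by auto
    then have 2: "ctx_equiv F (u0 @ ?c us' @ (Suc k # (ul @ h # v0)) @ ?c vs) (u0 @ ?c us' @ (Suc k # ul) @ ?c vs)"
      by (intro ctx_equiv_append ctx_equiv_refl ctx_equiv_Cons)
    have 3: "u0 @ ?c us' @ (Suc k # ul) @ ?c vs = u0 @ ?c (us @ vs)" by (simp add: us)
    have 4: "ctx_equiv F (?c (us @ vs)) (?c us)" using seg_step v by (intro many) auto
    show ?thesis unfolding 1
      by (rule ctx_equiv_trans[OF 2[unfolded 3] ctx_equiv_append[OF ctx_equiv_refl 4]])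
  qed
qed

lemma seg_letters: "seg n k u \<Longrightarrow> a \<in> set u \<Longrightarrow> a = 0 \<or> k < a"
proof (induction rule: seg.induct)
  case (seg_step k u0 us)
  then consider "a \<in> set u0" | "a = Suc k" | u where "u \<in> set us" "a \<in> set u"
    by (fastforce split: if_splits)
  then show ?case using seg_step.IH by cases auto
qed simp

text \<open>First the factor \<open>1 # v2\<close> is dropped, as \<open>length vs + 2\<close>
  factors remain and these are too many to be counted. Then \<open>h # v2\<close> is attached to
  \<open>v1\<close>, which cannot be noticed either.\<close>

lemma alert_equiv:
  assumes F: "\<forall>\<phi>\<in>F. fsize \<phi> \<le> n"
    and "\<forall>v\<in>set (v0 # v1 # v2 # vs). seg n 1 v" "n \<le> length vs + 2" "h = 0 \<or> 1 < h \<and> h \<le> n"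
  shows "ctx_equiv F (concat (map ((#) 1) (v0 # v1 # v2 # vs)))
     (1 # v0 @ 1 # v1 @ h # v2 @ concat (map ((#) 1) vs))"
proof -
  let ?c = "\<lambda>us. concat (map ((#) 1) us)"
  have 1: "ctx_equiv F (?c (v0 # v1 # v2 # vs)) (?c (v0 # v1 # vs))"
  proof (rule ctx_equiv_concat[OF F, where v = "1 # v0"])
    fix u assume "u \<in> set (map ((#) 1) (v0 # v1 # v2 # vs))"
    then obtain v where "u = 1 # v" "seg n 1 v" using assms(2) by auto
    then show "ctx_equiv F u (1 # v0)"
      using assms(2) ctx_equiv_Cons[OF seg_equiv[OF F]] by simp
  next
    fix u assume "u \<in> set (map ((#) 1) (v0 # v1 # vs))"
    then obtain v where "u = 1 # v" "seg n 1 v" using assms(2) by auto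
    then show "ctx_equiv F u (1 # v0)"
      using assms(2) ctx_equiv_Cons[OF seg_equiv[OF F]] by simp
  qed (use assms in auto)
  have "ctx_equiv F (v1 @ h # v2) v1"
    using assms by (intro seg_merge[OF F, where k = 1]) auto
  then have 2: "ctx_equiv F ((1 # v0) @ (1 # (v1 @ h # v2)) @ ?c vs) ((1 # v0) @ (1 # v1) @ ?c vs)"
    by (intro ctx_equiv_append ctx_equiv_refl ctx_equiv_Cons)
  show ?thesis using ctx_equiv_trans[OF 1, of "1 # v0 @ 1 # v1 @ h # v2 @ ?c vs"] ctx_equiv_sym[OF 2]
    by simp
qed

section \<open>The fractal word\<close>

text \<open>Every \<open>{p}\<close> starts a block, so the blocks can be read off the word. This
  identifies the blocks provided by \<open>fractal\<close> with those computed from an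
  expansion.\<close>

lemma n_block_concat_unique:
  assumes "\<forall>b\<in>set bs. n_block p n b" "\<forall>b\<in>set cs. n_block p n b" "concat bs = concat cs"
  shows "bs = cs"
  using assms
proof (induction bs arbitrary: cs)
  case Nil
  then show ?case by (cases cs) (auto simp: n_block_def)
next
  case (Cons b bs)
  then obtain c cs' where cs: "cs = c # cs'" by (cases cs) (auto simp: n_block_def)
  from Cons.prems(1) obtain m where m: "b = {p} # replicate m {}" by (auto simp: n_block_def)
  from Cons.prems(2) cs obtain m' where m': "c = {p} # replicate m' {}" by (auto simp: n_block_def)
  have tw: "takeWhile (\<lambda>a. a = {}) (replicate k {} @ concat ds) = replicate k {}"
    if "\<forall>b\<in>set ds. n_block p n b" for k ds
    using that by (cases ds) (auto simp: takeWhile_append n_block_def)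
  have "replicate m {} @ concat bs = replicate m' {} @ concat cs'"
    using Cons.prems(3) by (simp add: cs m m')
  then have "replicate m ({} :: 'a set) = replicate m' {}"
    using tw[of bs m] tw[of cs' m'] Cons.prems(1,2) cs by (metis list.set_intros(2))
  then have "b = c" using m m' by simp
  moreover have "bs = cs'" using Cons.IH[of cs'] Cons.prems cs \<open>b = c\<close> by simp
  ultimately show ?case by (simp add: cs)
qed

text \<open>The initial gap of the expansion lies under the head \<open>{p}\<close> of
  \<open>b\<close>, and the union turns it into the additional block \<open>e\<close>. Elsewhere
  \<open>b\<close> is empty and contributes nothing.\<close>

lemma block_refine:
  assumes "n_block p n b" "block_expansion p n u" "length u = length b"
  obtains e bs where "map2 (\<union>) b u = e @ concat bs" "u = replicate (length e) {} @ concat bs"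
    "n_block p n e" "length bs = n + 4" "\<forall>b\<in>set bs. n_block p n b"
proof -
  from assms(1) obtain m where m: "b = {p} # replicate m {}" by (auto simp: n_block_def)
  from assms(2) obtain g bs where u: "u = replicate g {} @ concat bs" "n + 2 \<le> g"
    "length bs = n + 4" "\<forall>b\<in>set bs. n_block p n b" by (auto simp: block_expansion_def)
  from u(2) obtain g' where g: "g = Suc g'" by (cases g) auto
  have len: "m = g' + length (concat bs)" using assms(3) by (simp add: m u(1) g)
  have z: "map2 (\<union>) (replicate (length xs) {}) xs = xs" for xs :: "'a set list"
    by (induction xs) auto
  have "map2 (\<union>) b u = ({p} # replicate g' {}) @ concat bs"
    using z[of "replicate g' {} @ concat bs"] by (simp add: m u(1) g len)
  then show thesis using u by (intro that[of "{p} # replicate g' {}" bs]) (auto simp: n_block_def g)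
qed

lemma blocks_refine:
  assumes "list_all2 (\<lambda>b u. length u = length b \<and> block_expansion p n u) bs us"
    "\<forall>b\<in>set bs. n_block p n b"
  shows "\<exists>fs. (\<forall>f\<in>set fs. n_block p n f) \<and> map2 (\<union>) (concat bs) (concat us) = concat fs"
  using assms
proof (induction rule: list_all2_induct)
  case (Cons b bs u us)
  then obtain fs where fs: "\<forall>f\<in>set fs. n_block p n f" "map2 (\<union>) (concat bs) (concat us) = concat fs"
    by auto
  obtain e gs where "map2 (\<union>) b u = e @ concat gs" "n_block p n e" "\<forall>b\<in>set gs. n_block p n b"
    using block_refine[of p n b u] Cons.hyps(1) Cons.prems by (metis list.set_intros(1))
  with fs Cons(1) show ?case by (intro exI[of _ "e # gs @ fs"]) auto
qed (intro exI[of _ "[]"], simp)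

lemma list_all2_length_concat:
  "list_all2 (\<lambda>b u. length u = length b \<and> Q u) bs us \<Longrightarrow> length (concat us) = length (concat bs)"
  by (induction rule: list_all2_induct) auto

text \<open>A block carries \<open>p\<close> only at its head, where its expansion begins with a
  non-empty gap.\<close>

lemma expansion_avoids_blocks:
  assumes "list_all2 (\<lambda>b u. length u = length b \<and> block_expansion p n u) bs us"
    "\<forall>b\<in>set bs. n_block p n b" "i < length (concat bs)" "p \<in> concat bs ! i"
  shows "concat us ! i = {}"
  using assms
proof (induction arbitrary: i rule: list_all2_induct)
  case (Cons b bs u us)
  show ?case
  proof (cases "i < length b")
    case True
    with Cons.prems have "p \<in> b ! i" by (simp add: nth_append)
    moreover from Cons.prems obtain m where "b = {p} # replicate m {}" by (auto simp: n_block_def)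
    ultimately have "i = 0" using True by (cases i) auto
    then show ?thesis using Cons(1) True by (auto simp: block_expansion_def nth_append)
  next
    case False
    then show ?thesis using Cons.prems Cons(1) Cons.IH[of "i - length b"] by (auto simp: nth_append)
  qed
qed simp

lemma subsequence_split:
  "i \<le> j \<Longrightarrow> j \<le> k \<Longrightarrow> subsequence c i k = subsequence c i j @ subsequence c j k"
  using upt_add_eq_append[of i j "k - j"] by (simp add: subsequence_def)

text \<open>Used to read the letters of \<open>c\<close> below a list of blocks: each block
  contributes its head letter \<open>x\<close> and a remainder satisfying \<open>Q\<close>. The
  decomposition of \<open>bs\<close> gives access to the absolute position of each block.\<close>

lemma subsequence_blocks:
  assumes "\<And>bs1 b bs2. bs = bs1 @ b # bs2 \<Longrightarrow> b \<noteq> [] \<and> c (s + length (concat bs1)) = x \<and>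
      Q (subsequence c (Suc (s + length (concat bs1))) (s + length (concat bs1) + length b))"
  shows "\<exists>vs. length vs = length bs \<and> (\<forall>v\<in>set vs. Q v) \<and>
    subsequence c s (s + length (concat bs)) = concat (map ((#) x) vs)"
  using assms
proof (induction bs arbitrary: s)
  case (Cons b bs)
  have "\<exists>vs. length vs = length bs \<and> (\<forall>v\<in>set vs. Q v) \<and>
    subsequence c (s + length b) (s + length b + length (concat bs)) = concat (map ((#) x) vs)"
  proof (rule Cons.IH)
    fix bs1 b' bs2 assume "bs = bs1 @ b' # bs2"
    then show "b' \<noteq> [] \<and> c (s + length b + length (concat bs1)) = x \<and>
      Q (subsequence c (Suc (s + length b + length (concat bs1))) (s + length b + length (concat bs1) + length b'))"
      using Cons.prems[of "b # bs1" b' bs2] by (simp add: add.assoc)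
  qed
  then obtain vs where vs: "length vs = length bs" "\<forall>v\<in>set vs. Q v"
    "subsequence c (s + length b) (s + length b + length (concat bs)) = concat (map ((#) x) vs)" by blast
  have b: "b \<noteq> []" "c s = x" "Q (subsequence c (Suc s) (s + length b))" using Cons.prems[of "[]" b bs] by auto
  have "subsequence c s (s + length b) = c s # subsequence c (Suc s) (s + length b)"
    using b(1) by (cases b) (auto simp: subsequence_def upt_conv_Cons simp del: upt_Suc)
  then have "subsequence c s (s + length (concat (b # bs))) = concat (map ((#) x) (subsequence c (Suc s) (s + length b) # vs))"
    using vs(3) b(2) subsequence_split[of s "s + length b" "s + length b + length (concat bs)" c]
    by (simp add: add.assoc)
  then show ?case using vs b by (intro exI[of _ "subsequence c (Suc s) (s + length b) # vs"]) auto
qed simp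

text \<open>Index 0 stands for \<open>\<pi>(\<eta>)\<close>; letter \<open>i\<close> of a word is the label of main position \<open>i + 1\<close>.\<close>

definition level :: "'a \<Rightarrow> nat \<Rightarrow> (nat \<Rightarrow> 'a set list) \<Rightarrow> nat \<Rightarrow> nat" where
  "level p n w i = (if i < length (w 1) \<and> (\<exists>k\<in>{1..n}. p \<in> w k ! i)
     then THE k. k \<in> {1..n} \<and> p \<in> w k ! i else 0)"

lemma join_nth:
  "1 \<le> k \<Longrightarrow> i < length (w 1) \<Longrightarrow> join (map w [1..<Suc k]) ! i = (\<Union>j\<in>{1..k}. w j ! i)"
proof -
  assume "1 \<le> k" "i < length (w 1)"
  moreover from this have "hd (map w [1..<Suc k]) = w 1" by (simp add: upt_conv_Cons del: upt_Suc)
  moreover have "{1..<Suc k} = {1..k}" by auto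
  ultimately show ?thesis by (simp add: join_def del: upt_Suc)
qed

lemma join_length: "1 \<le> k \<Longrightarrow> length (join (map w [1..<Suc k])) = length (w 1)"
  by (simp add: join_def upt_conv_Cons del: upt_Suc)

text \<open>No two words share a \<open>p\<close>: an occurrence in \<open>w a\<close> with
  \<open>a < b\<close> is visible in the join of the words before \<open>w b\<close>, hence is the
  head of a block, and there \<open>w b\<close> is empty. This justifies the definite description in
  \<open>level\<close>.\<close>

lemma fractal_level:
  assumes "fractal p n w" "k \<in> {1..n}" "i < length (w 1)" "p \<in> w k ! i"
  shows "level p n w i = k"
proof -
  have disj: False if "a \<in> {1..n}" "b \<in> {1..n}" "a < b" "p \<in> w a ! i" "p \<in> w b ! i" for a b
  proof -
    from \<open>a < b\<close> obtain b' where b': "b = Suc b'" "a \<le> b'" by (cases b) auto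
    then have b'n: "b' \<in> {1..n}" "b' < n" using that by auto
    from assms(1) b'n obtain bs us where bs: "\<forall>b\<in>set bs. n_block p n b"
      "join (map w [1..<Suc b']) = concat bs @ [{p}]"
      "list_all2 (\<lambda>b u. length u = length b \<and> block_expansion p n u) bs us"
      "w b = concat us @ [{}]"
      unfolding fractal_def b'(1) by blast
    have len: "length (w 1) = Suc (length (concat bs))"
      using join_length[of b' w] bs(2) b'n by simp
    have "p \<in> (concat bs @ [{p}]) ! i"
      using join_nth[of b' i w] assms(3) that b' b'n unfolding bs(2)[symmetric] by auto
    \<comment> \<open>The last position lies outside the blocks; there the final \<open>{}\<close>
      of \<open>w b\<close> gives the contradiction.\<close>
    then show False
      using that(5) expansion_avoids_blocks[OF bs(3,1), of i] list_all2_length_concat[OF bs(3)]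
        len assms(3) unfolding bs(4) by (auto simp: nth_append split: if_splits)
  qed
  have "(THE k. k \<in> {1..n} \<and> p \<in> w k ! i) = k"
    using assms disj by (intro the_equality) (auto, meson linorder_neqE_nat)
  then show ?thesis using assms by (auto simp: level_def)
qed

text \<open>The part of a level-\<open>k\<close> block after its head is a segment of level
  \<open>k\<close>, by induction from \<open>k = n\<close> downwards. The blocks of
  \<open>w 1\<close> then yield \<open>vs\<close>, its final \<open>{p}\<close> the last 1, and the
  default value of \<open>level\<close> the zeros.\<close>

lemma fractal_seg:
  assumes fr: "fractal p n w" and "1 \<le> n"
  obtains vs where "length vs = n + 4" "\<forall>v\<in>set vs. seg n 1 v"
    "level p n w = (concat (map ((#) 1) vs) @ [1]) \<frown> (\<lambda>_. 0)"
proof -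
  let ?c = "level p n w" and ?l = "length (w 1)"
  let ?E = "list_all2 (\<lambda>b u. length u = length b \<and> block_expansion p n u)"
  from fr obtain bl where len1: "length (bl 1) = n + 4"
    and bl: "\<forall>k\<in>{1..n}. (\<forall>b\<in>set (bl k). n_block p n b) \<and>
      join (map w [1..<Suc k]) = concat (bl k) @ [{p}] \<and>
      (k < n \<longrightarrow> (\<exists>us. ?E (bl k) us \<and> w (Suc k) = concat us @ [{}]))"
    unfolding fractal_def by (elim conjE exE)
  have blk: "\<forall>b\<in>set (bl k). n_block p n b"
    and jn: "join (map w [1..<Suc k]) = concat (bl k) @ [{p}]"
    and ex: "k < n \<Longrightarrow> \<exists>us. ?E (bl k) us \<and> w (Suc k) = concat us @ [{}]"
    if "k \<in> {1..n}" for k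
    using bl that by blast+
  have len: "length (concat (bl k)) + 1 = ?l" if "k \<in> {1..n}" for k
    using join_length[of k w] jn[OF that] that by simp
  have main: "seg n k (subsequence ?c (Suc (length (concat pre))) (length (concat pre) + length b))"
    if "k \<in> {1..n}" "bl k = pre @ b # post" for k pre b post
    using that
  proof (induction "n - k" arbitrary: k pre b post)
    case 0
    then have k: "k = n" by simp
    \<comment> \<open>A block has length at least \<open>n + 2\<close> including its head, which
      leaves the \<open>n + 1\<close> zeros required by \<open>seg_base\<close>.\<close>
    from blk[of n] 0 assms(2) obtain m where m: "b = {p} # replicate m {}" "n + 1 \<le> m"
      by (auto simp: n_block_def k)
    have "?c i = 0" if i: "Suc (length (concat pre)) \<le> i" "i < length (concat pre) + length b" for i
    proof -
      have "i < length (concat (bl n))" using i 0(3) by (simp add: k)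
      then have "concat (bl n) ! i = b ! (i - length (concat pre))" and "i < ?l"
        using i 0(3) len[of n] assms(2) by (auto simp: k nth_append)
      moreover have "b ! (i - length (concat pre)) = {}"
        using i unfolding m(1) by (cases "i - length (concat pre)") auto
      ultimately have "(\<Union>j\<in>{1..n}. w j ! i) = {}"
        using join_nth[of n i w] jn[of n] assms(2) \<open>i < length (concat (bl n))\<close>
        by (simp add: nth_append)
      then show ?thesis by (auto simp: level_def)
    qed
    then have "subsequence ?c (Suc (length (concat pre))) (length (concat pre) + length b) = replicate m 0"
      by (intro nth_equalityI) (simp_all add: m(1) del: subseq_to_Suc)
    then show ?case using m(2) by (simp add: k seg_base)
  next
    case (Suc d)
    then have k: "k < n" "Suc k \<in> {1..n}" "d = n - Suc k" by auto
    from ex[OF Suc.prems(1) k(1)] obtain us where us: "?E (bl k) us" "w (Suc k) = concat us @ [{}]"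
      by blast
    from us(1) Suc.prems(2) obtain upre u upost where us_split: "us = upre @ u # upost"
      "?E pre upre" "length u = length b" "block_expansion p n u" "?E post upost"
      by (auto simp: list_all2_append1 list_all2_Cons1)
    have nb: "n_block p n b" "\<forall>b\<in>set pre. n_block p n b" "\<forall>b\<in>set post. n_block p n b"
      using blk[OF Suc.prems(1)] Suc.prems(2) by auto
    obtain e bs where e: "map2 (\<union>) b u = e @ concat bs" "u = replicate (length e) {} @ concat bs"
      "n_block p n e" "length bs = n + 4" "\<forall>b\<in>set bs. n_block p n b"
      using block_refine[OF nb(1) us_split(4,3)] by blast
    obtain fpre where fpre: "\<forall>f\<in>set fpre. n_block p n f" "map2 (\<union>) (concat pre) (concat upre) = concat fpre"
      using blocks_refine[OF us_split(2) nb(2)] by blast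
    obtain fpost where fpost: "\<forall>f\<in>set fpost. n_block p n f" "map2 (\<union>) (concat post) (concat upost) = concat fpost"
      using blocks_refine[OF us_split(5) nb(3)] by blast
    have lpre: "length (concat upre) = length (concat pre)"
      using list_all2_length_concat[OF us_split(2)] .
    have lfpre: "length (concat fpre) = length (concat pre)"
      using lpre unfolding fpre(2)[symmetric] by simp
    have lb: "length b = length e + length (concat bs)"
      using us_split(3) by (simp add: e(2))
    have "join (map w [1..<Suc (Suc k)]) = map2 (\<union>) (join (map w [1..<Suc k])) (w (Suc k))"
    proof (rule nth_equalityI)
      have "length (w (Suc k)) = ?l"
        using list_all2_length_concat[OF us(1)] us(2) len[OF Suc.prems(1)] by simp
      then show l: "length (join (map w [1..<Suc (Suc k)])) = length (map2 (\<union>) (join (map w [1..<Suc k])) (w (Suc k)))"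
        using join_length[of k w] join_length[of "Suc k" w] Suc.prems(1) by simp
      fix i assume "i < length (join (map w [1..<Suc (Suc k)]))"
      then show "join (map w [1..<Suc (Suc k)]) ! i = map2 (\<union>) (join (map w [1..<Suc k])) (w (Suc k)) ! i"
        using join_length[of k w] join_length[of "Suc k" w] Suc.prems(1) l
          join_nth[of k i w] join_nth[of "Suc k" i w]
        by (auto simp: atLeastAtMostSuc_conv simp del: upt_Suc)
    qed
    \<comment> \<open>Expanding \<open>b\<close> splits it into \<open>e # bs\<close>, while its
      neighbours are refined separately; the final \<open>{p}\<close> meets the final
      \<open>{}\<close> of \<open>w (Suc k)\<close>.\<close>
    then have "concat (bl (Suc k)) @ [{p}] = concat (fpre @ (e # bs) @ fpost) @ [{p}]"
      unfolding jn[OF k(2)] jn[OF Suc.prems(1)] us(2) Suc.prems(2) us_split(1)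
      using list_all2_length_concat[OF us_split(5)] lpre us_split(3)
      by (simp add: e(1) fpre(2)[symmetric] fpost(2)[symmetric])
    then have blS: "bl (Suc k) = fpre @ (e # bs) @ fpost"
      using fpre(1) e(3,5) fpost(1) blk[OF k(2)] by (intro n_block_concat_unique[of _ p n]) auto
    let ?s = "length (concat pre)"
    \<comment> \<open>The block \<open>e\<close> starts where \<open>b\<close> does, so its
      remainder is the initial segment; the blocks of \<open>bs\<close> supply the factors headed by
      \<open>Suc k\<close>.\<close>
    have "seg n (Suc k) (subsequence ?c (Suc ?s) (?s + length e))"
      using Suc.hyps(1)[OF k(3,2), of fpre e "bs @ fpost"] blS lfpre by simp
    moreover have "\<exists>vs. length vs = length bs \<and> (\<forall>v\<in>set vs. seg n (Suc k) v) \<and>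
      subsequence ?c ((?s + length e)) ((?s + length e) + length (concat bs)) = concat (map ((#) (Suc k)) vs)"
    proof (rule subsequence_blocks, intro conjI)
      fix bs1 b' bs2 assume bs: "bs = bs1 @ b' # bs2"
      let ?q = "?s + length e + length (concat bs1)"
      from e(5) bs obtain m where m: "b' = {p} # replicate m {}" by (auto simp: n_block_def)
      then show "b' \<noteq> []" by simp
      have "w (Suc k) ! ?q = {p}"
        unfolding us(2) us_split(1) e(2) bs m using lpre by (simp add: nth_append)
      moreover have "?q < ?l"
        using len[OF Suc.prems(1)] Suc.prems(2) lb bs by simp
      ultimately show "?c ?q = Suc k" using fractal_level[OF fr k(2)] by simp
      show "seg n (Suc k) (subsequence ?c (Suc ?q) (?q + length b'))"
        using Suc.hyps(1)[OF k(3,2), of "fpre @ e # bs1" b' "bs2 @ fpost"] blS lfpre bs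
        by (simp add: add.assoc)
    qed
    then obtain vs where vs: "length vs = length bs" "\<forall>v\<in>set vs. seg n (Suc k) v"
      "subsequence ?c ((?s + length e)) ((?s + length e) + length (concat bs)) = concat (map ((#) (Suc k)) vs)"
      by blast
    moreover have "subsequence ?c (Suc ?s) (?s + length b) = subsequence ?c (Suc ?s) (?s + length e) @ concat (map ((#) (Suc k)) vs)"
      using subsequence_split[of "Suc ?s" "?s + length e" "?s + length e + length (concat bs)" ?c] e(3) vs(3)
      by (auto simp: lb add.assoc n_block_def)
    ultimately show ?case using k e(4) by (auto intro!: seg_step)
  qed
  have one: "1 \<in> {1..n}" using assms(2) by simp
  have w1: "w 1 = concat (bl 1) @ [{p}]"
    using jn[OF one] by (simp add: join_def map_nth)
  have "\<exists>vs. length vs = length (bl 1) \<and> (\<forall>v\<in>set vs. seg n 1 v) \<and>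
      subsequence ?c 0 (0 + length (concat (bl 1))) = concat (map ((#) 1) vs)"
  proof (rule subsequence_blocks, intro conjI)
    fix bs1 b bs2 assume bs: "bl 1 = bs1 @ b # bs2"
    from blk[OF one] bs obtain m where m: "b = {p} # replicate m {}" by (auto simp: n_block_def)
    then show "b \<noteq> []" by simp
    show "?c (0 + length (concat bs1)) = 1"
      by (rule fractal_level[OF fr one]) (simp_all only: w1 bs m, simp_all add: nth_append)
    show "seg n 1 (subsequence ?c (Suc (0 + length (concat bs1))) (0 + length (concat bs1) + length b))"
      using main[OF one bs] by simp
  qed
  then obtain vs where vs: "length vs = n + 4" "\<forall>v\<in>set vs. seg n 1 v"
      "subsequence ?c 0 (length (concat (bl 1))) = concat (map ((#) 1) vs)"
    using len1 by auto
  have "?c (length (concat (bl 1))) = 1"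
    by (rule fractal_level[OF fr one]) (simp_all only: w1, simp_all)
  then have "subsequence ?c 0 (?l) = concat (map ((#) 1) vs) @ [1]"
    using vs(3) by (simp only: w1) simp
  moreover have "suffix ?l ?c = (\<lambda>_. 0)" by (auto simp: level_def)
  ultimately have "?c = (concat (map ((#) 1) vs) @ [1]) \<frown> (\<lambda>_. 0)"
    using prefix_suffix[of ?c ?l] by simp
  then show thesis using that vs by blast
qed

section \<open>From structures to words\<close>

lemma sorted_list_of_set_third:
  fixes A :: "nat set"
  assumes "finite A" "x \<in> A" "y \<in> A" "z \<in> A" "x < y" "y < z" "\<And>i. i \<in> A \<Longrightarrow> i < z \<Longrightarrow> i = x \<or> i = y"
  shows "sorted_list_of_set A ! 2 = z"
proof -
  let ?B = "A - {x, y, z}"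
  have B: "z < i" if "i \<in> ?B" for i
    using that assms(7)[of i] by (cases "i < z") auto
  have "sorted (x # y # z # sorted_list_of_set ?B)" "distinct (x # y # z # sorted_list_of_set ?B)"
    using assms B by fastforce+
  moreover have "set (x # y # z # sorted_list_of_set ?B) = A" using assms by auto
  ultimately have "sorted_list_of_set A = x # y # z # sorted_list_of_set ?B"
    by (metis sorted_list_of_set.idem_if_sorted_distinct)
  then show ?thesis by (simp add: numeral_2_eq_2)
qed

lemma alert_word:
  fixes c :: "nat word"
  assumes c: "c = (concat (map ((#) 1) vs) @ [1]) \<frown> (\<lambda>_. 0)"
    and vs: "length vs = n + 4" "\<forall>v\<in>set vs. seg n 1 v"
  obtains a where "sorted_list_of_set (Suc ` {i. c i = 1}) ! 2 = Suc a" "c a = 1"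
    "\<And>h (\<phi> :: ('a, 'v) hyperctl) \<rho> y. fsize \<phi> \<le> n \<Longrightarrow> h = 0 \<or> 1 < h \<and> h \<le> n \<Longrightarrow>
       wsat \<rho> y c \<phi> \<longleftrightarrow> wsat \<rho> y (c(a := h)) \<phi>"
proof -
  obtain v0 v1 v2 vs' where v: "vs = v0 # v1 # v2 # vs'"
    using vs(1) by (cases vs; cases "tl vs"; cases "tl (tl vs)") auto
  \<comment> \<open>Segments of level 1 contain no letter 1, so these are the second and third
    occurrences of 1, the first being at 0. Main positions are larger by one, whence the
    \<open>Suc\<close> below.\<close>
  let ?a = "length v0 + 1" and ?b = "length v0 + length v1 + 2"
  let ?r = "(v2 @ concat (map ((#) 1) vs') @ [1]) \<frown> (\<lambda>_. 0)"
  have c': "c = (1 # v0 @ 1 # v1 @ [1]) \<frown> ?r" unfolding c v by simp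
  have no: "1 \<notin> set v0" "1 \<notin> set v1" using vs(2) v seg_letters[of n 1 _ 1] by auto
  have ones: "c 0 = 1" "c ?a = 1" "c ?b = 1"
    unfolding c' by (simp_all add: conc_def nth_append nth_Cons')
  have "sorted_list_of_set (Suc ` {i. c i = 1}) ! 2 = Suc ?b"
  proof (rule sorted_list_of_set_third[of _ "Suc 0" "Suc ?a"])
    have "{i. c i = 1} \<subseteq> {..<length (concat (map ((#) 1) vs) @ [1])}"
      unfolding c by (auto simp: conc_def split: if_splits)
    then show "finite (Suc ` {i. c i = 1})" using finite_subset by blast
    fix j assume "j \<in> Suc ` {i. c i = 1}" "j < Suc ?b"
    then obtain i where i: "j = Suc i" "c i = 1" "i < ?b" by auto
    then have "(1 # v0 @ 1 # v1 @ [1]) ! i = 1" unfolding c' by (simp add: conc_def)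
    then have "i = 0 \<or> i = ?a"
      using i(3) no by (force simp: nth_append nth_Cons' in_set_conv_nth split: if_splits)
    then show "j = Suc 0 \<or> j = Suc ?a" using i(1) by auto
  qed (use ones in auto)
  moreover have "wsat \<rho> y c \<phi> \<longleftrightarrow> wsat \<rho> y (c(?b := h)) \<phi>"
    if "fsize \<phi> \<le> n" "h = 0 \<or> 1 < h \<and> h \<le> n" for h and \<phi> :: "('a, 'v) hyperctl" and \<rho> y
  proof -
    have "c(?b := h) = (1 # v0 @ 1 # v1 @ [h]) \<frown> ?r"
      unfolding c' by (auto simp: fun_eq_iff conc_def nth_append nth_Cons')
    moreover have "\<dots> = [] \<frown> (1 # v0 @ 1 # v1 @ h # v2 @ concat (map ((#) 1) vs')) \<frown> ([1] \<frown> (\<lambda>_. 0))"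
      by (simp only: conc_conc append.simps append_assoc)
    moreover have "c = [] \<frown> concat (map ((#) 1) (v0 # v1 # v2 # vs')) \<frown> ([1] \<frown> (\<lambda>_. 0))"
      unfolding c v by (simp only: conc_conc append.simps append_assoc)
    moreover have "ctx_equiv {\<phi>} (concat (map ((#) 1) (v0 # v1 # v2 # vs')))
       (1 # v0 @ 1 # v1 @ h # v2 @ concat (map ((#) 1) vs'))"
      using vs v that by (intro alert_equiv[of _ n]) auto
    ultimately show ?thesis unfolding ctx_equiv_def by (metis singletonI)
  qed
  ultimately show thesis using ones(3) by (intro that[of ?b])
qed

text \<open>By \<open>det\<close>, a prefix that includes position 1 fixes the path, so a quantifier
  can only copy the current one. Labels matter for indices in \<open>I\<close> only; a letter
  outside \<open>I\<close> means that none of these paths carries \<open>p\<close>.\<close>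

lemma sat_wsat:
  assumes det: "\<And>k \<pi> i. k \<in> I \<Longrightarrow> initial_path L \<pi> \<Longrightarrow> \<forall>j\<le>Suc i. \<pi> j = P k j \<Longrightarrow> \<pi> = P k"
    and path: "\<And>k. k \<in> I \<Longrightarrow> initial_path L (P k)"
    and val: "\<And>k i. k \<in> I \<Longrightarrow> p \<in> val L (P k (Suc i)) \<longleftrightarrow> c i = k"
    and "props \<phi> \<subseteq> {p}" "\<forall>x\<in>insert y (free_vars \<phi>). \<rho> x \<in> I \<and> \<Pi> x = P (\<rho> x)"
  shows "sat L \<Pi> y (Suc i) \<phi> \<longleftrightarrow> wsat \<rho> y (suffix i c) \<phi>"
  using assms(4,5)
proof (induction \<phi> arbitrary: \<Pi> \<rho> y i)
  case (Atom q x)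
  then show ?case using val by auto
next
  case (Until \<phi> \<psi>)
  have IH: "sat L \<Pi> y (Suc j) \<phi> \<longleftrightarrow> wsat \<rho> y (suffix j c) \<phi>"
    "sat L \<Pi> y (Suc j) \<psi> \<longleftrightarrow> wsat \<rho> y (suffix j c) \<psi>" for j
    using Until.prems by (intro Until.IH; simp)+
  show ?case
  proof
    assume "sat L \<Pi> y (Suc i) (Until \<phi> \<psi>)"
    then obtain j where j: "Suc i \<le> j" "sat L \<Pi> y j \<psi>" "\<And>k. Suc i \<le> k \<Longrightarrow> k < j \<Longrightarrow> sat L \<Pi> y k \<phi>"
      by auto
    then have "j = Suc (i + (j - Suc i))" by simp
    with j(2) IH(2) have "wsat \<rho> y (suffix (i + (j - Suc i)) c) \<psi>" by metis
    moreover have "wsat \<rho> y (suffix (i + k) c) \<phi>" if "k < j - Suc i" for k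
      using j(3)[of "Suc (i + k)"] that IH(1) by auto
    ultimately show "wsat \<rho> y (suffix i c) (Until \<phi> \<psi>)" by auto
  next
    assume "wsat \<rho> y (suffix i c) (Until \<phi> \<psi>)"
    then obtain j where j: "wsat \<rho> y (suffix (i + j) c) \<psi>" "\<And>k. k < j \<Longrightarrow> wsat \<rho> y (suffix (i + k) c) \<phi>"
      by auto
    have "sat L \<Pi> y k \<phi>" if "Suc i \<le> k" "k < Suc (i + j)" for k
    proof -
      from that have "k = Suc (i + (k - Suc i))" "k - Suc i < j" by auto
      with j(2) IH(1) show ?thesis by metis
    qed
    with j(1) IH(2) have "Suc i \<le> Suc (i + j) \<and> sat L \<Pi> y (Suc (i + j)) \<psi> \<and>
      (\<forall>k. Suc i \<le> k \<and> k < Suc (i + j) \<longrightarrow> sat L \<Pi> y k \<phi>)" by auto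
    then show "sat L \<Pi> y (Suc i) (Until \<phi> \<psi>)" unfolding sat.simps by blast
  qed
next
  case (Ex x \<phi>)
  have y: "\<rho> y \<in> I" "\<Pi> y = P (\<rho> y)" using Ex.prems by auto
  then have "initial_path L \<pi> \<and> (\<forall>j\<le>Suc i. \<pi> j = \<Pi> y j) \<longleftrightarrow> \<pi> = \<Pi> y" for \<pi>
    using det[of "\<rho> y" \<pi> i] path by auto
  then have "sat L \<Pi> y (Suc i) (Ex x \<phi>) \<longleftrightarrow> sat L (\<Pi>(x := \<Pi> y)) x (Suc i) \<phi>"
    by (simp add: conj_assoc[symmetric] del: conj_assoc)
  also have "\<dots> \<longleftrightarrow> wsat (\<rho>(x := \<rho> y)) x (suffix i c) \<phi>"
    using Ex.prems by (intro Ex.IH) auto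
  finally show ?case unfolding wsat.simps .
next
  case (Conj \<phi> \<psi>)
  have "sat L \<Pi> y (Suc i) \<phi> \<longleftrightarrow> wsat \<rho> y (suffix i c) \<phi>"
    "sat L \<Pi> y (Suc i) \<psi> \<longleftrightarrow> wsat \<rho> y (suffix i c) \<psi>"
    using Conj.prems by (intro Conj.IH; simp)+
  then show ?case by (simp only: sat.simps wsat.simps)
qed auto

lemma finite_free_vars [simp]: "finite (free_vars \<phi>)"
  by (induction \<phi>) auto

text \<open>Separates position 0, where quantifiers still branch, from the positions where paths are
  fixed.\<close>

lemma sat_Until_unfold:
  "sat K \<Pi> y i (Until \<phi> \<psi>) \<longleftrightarrow>
     sat K \<Pi> y i \<psi> \<or> sat K \<Pi> y i \<phi> \<and> sat K \<Pi> y (Suc i) (Until \<phi> \<psi>)"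
proof
  assume "sat K \<Pi> y i (Until \<phi> \<psi>)"
  then obtain j where j: "i \<le> j" "sat K \<Pi> y j \<psi>" "\<forall>k. i \<le> k \<and> k < j \<longrightarrow> sat K \<Pi> y k \<phi>" by auto
  show "sat K \<Pi> y i \<psi> \<or> sat K \<Pi> y i \<phi> \<and> sat K \<Pi> y (Suc i) (Until \<phi> \<psi>)"
  proof (cases "j = i")
    case False
    with j have "Suc i \<le> j" "sat K \<Pi> y i \<phi>" "\<forall>k. Suc i \<le> k \<and> k < j \<longrightarrow> sat K \<Pi> y k \<phi>" by auto
    with j(2) show ?thesis unfolding sat.simps by blast
  qed (use j in simp)
next
  assume "sat K \<Pi> y i \<psi> \<or> sat K \<Pi> y i \<phi> \<and> sat K \<Pi> y (Suc i) (Until \<phi> \<psi>)"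
  then show "sat K \<Pi> y i (Until \<phi> \<psi>)"
  proof
    assume "sat K \<Pi> y i \<phi> \<and> sat K \<Pi> y (Suc i) (Until \<phi> \<psi>)"
    then obtain j where j: "Suc i \<le> j" "sat K \<Pi> y j \<psi>" "\<forall>k. Suc i \<le> k \<and> k < j \<longrightarrow> sat K \<Pi> y k \<phi>"
      "sat K \<Pi> y i \<phi>" by auto
    then have "\<forall>k. i \<le> k \<and> k < j \<longrightarrow> sat K \<Pi> y k \<phi>" by (metis Suc_leI le_neq_implies_less)
    with j show ?thesis unfolding sat.simps by (meson Suc_leD)
  qed auto
qed

text \<open>Every quantifier evaluated at position 0 adds at most one path to those in use, so that the
  paths in use together with the remaining size never exceed \<open>n\<close>.\<close>

lemma sat_transfer:
  assumes paths: "\<And>\<pi>. initial_path M \<pi> \<longleftrightarrow> initial_path K \<pi>"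
    and root: "val M (init K) = val K (init K)"
    and one: "\<And>(\<phi> :: ('a, 'v) hyperctl) \<Pi> y. props \<phi> \<subseteq> {p} \<Longrightarrow> fsize \<phi> < n \<Longrightarrow> \<forall>x. initial_path K (\<Pi> x) \<Longrightarrow>
      card (\<Pi> ` insert y (free_vars \<phi>)) < n \<Longrightarrow> sat K \<Pi> y 1 \<phi> \<longleftrightarrow> sat M \<Pi> y 1 \<phi>"
    and "props (\<phi> :: ('a, 'v) hyperctl) \<subseteq> {p}" "\<forall>x. initial_path K (\<Pi> x)"
    and "card (\<Pi> ` insert y (free_vars \<phi>)) + fsize \<phi> \<le> n"
  shows "sat K \<Pi> y 0 \<phi> \<longleftrightarrow> sat M \<Pi> y 0 \<phi>"
  using assms(4-)
proof (induction \<phi> arbitrary: \<Pi> y)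
  case (Atom q x)
  then have "\<Pi> x 0 = init K" by (auto simp: initial_path_def)
  then show ?case using root by simp
next
  case (Conj \<phi> \<psi>)
  have "card (\<Pi> ` insert y (free_vars \<phi>)) \<le> card (\<Pi> ` insert y (free_vars (Conj \<phi> \<psi>)))"
    "card (\<Pi> ` insert y (free_vars \<psi>)) \<le> card (\<Pi> ` insert y (free_vars (Conj \<phi> \<psi>)))"
    by (intro card_mono; auto)+
  then show ?case using Conj by simp
next
  case (Next \<phi>)
  moreover have "card (\<Pi> ` insert y (free_vars \<phi>)) > 0" by (simp add: card_gt_0_iff)
  ultimately show ?case using one[of \<phi> \<Pi> y] fsize_pos[of \<phi>] by simp
next
  case (Until \<phi> \<psi>)
  have "card (\<Pi> ` insert y (free_vars \<phi>)) \<le> card (\<Pi> ` insert y (free_vars (Until \<phi> \<psi>)))"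
    "card (\<Pi> ` insert y (free_vars \<psi>)) \<le> card (\<Pi> ` insert y (free_vars (Until \<phi> \<psi>)))"
    by (intro card_mono; auto)+
  then have eq: "sat K \<Pi> y 0 \<phi> \<longleftrightarrow> sat M \<Pi> y 0 \<phi>" "sat K \<Pi> y 0 \<psi> \<longleftrightarrow> sat M \<Pi> y 0 \<psi>"
    using Until by simp_all
  have "0 < card (\<Pi> ` insert y (free_vars (Until \<phi> \<psi>)))" by (simp add: card_gt_0_iff)
  \<comment> \<open>At least the current path is in use and sizes are positive, which yields the
    strict bounds demanded by \<open>one\<close>.\<close>
  moreover have "a < n \<and> b < n" if "a + b \<le> n" "0 < a" "0 < b" for a b :: nat using that by simp
  ultimately have "sat K \<Pi> y 1 (Until \<phi> \<psi>) \<longleftrightarrow> sat M \<Pi> y 1 (Until \<phi> \<psi>)"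
    using Until.prems fsize_pos[of "Until \<phi> \<psi>"] by (intro one) blast+
  with eq show ?case unfolding sat_Until_unfold[of _ \<Pi> y 0] by simp
next
  case (Ex x \<phi>)
  have "sat K (\<Pi>(x := \<pi>)) x 0 \<phi> \<longleftrightarrow> sat M (\<Pi>(x := \<pi>)) x 0 \<phi>" if "initial_path K \<pi>" for \<pi>
  proof (rule Ex.IH)
    have "card (\<Pi>(x := \<pi>) ` insert x (free_vars \<phi>)) \<le> card (insert \<pi> (\<Pi> ` insert y (free_vars (Ex x \<phi>))))"
      by (intro card_mono) auto
    also have "\<dots> \<le> Suc (card (\<Pi> ` insert y (free_vars (Ex x \<phi>))))" by (rule card_insert_le_m1) auto
    finally show "card (\<Pi>(x := \<pi>) ` insert x (free_vars \<phi>)) + fsize \<phi> \<le> n" using Ex.prems by simp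
  qed (use Ex.prems that in auto)
  then show ?case using paths by auto
qed auto

section \<open>Initial paths in tree structures\<close>

lemma tree_edge:
  assumes "tree_structure AP K" "(u, v) \<in> edges K"
  obtains i where "v = u @ [i]"
  using assms unfolding tree_structure_def by metis

lemma tree_path_length:
  assumes "tree_structure AP K" "initial_path K \<pi>"
  shows "length (\<pi> i) = i"
proof (induction i)
  case 0
  then show ?case using assms by (simp add: tree_structure_def initial_path_def)
next
  case (Suc i)
  have "(\<pi> i, \<pi> (Suc i)) \<in> edges K" using assms(2) by (simp add: initial_path_def)
  then obtain j where "\<pi> (Suc i) = \<pi> i @ [j]" by (rule tree_edge[OF assms(1)])
  then show ?case using Suc by simp
qed

text \<open>Each edge appends one number, so a node determines all its ancestors. With depth 1 this
  tells which successor of the root a path has taken.\<close>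

lemma tree_path_take:
  assumes "tree_structure AP K" "initial_path K \<pi>"
  shows "take i (\<pi> (i + d)) = \<pi> i"
proof (induction d)
  case 0
  then show ?case using tree_path_length[OF assms] by simp
next
  case (Suc d)
  have "(\<pi> (i + d), \<pi> (Suc (i + d))) \<in> edges K" using assms(2) by (simp add: initial_path_def)
  then obtain j where "\<pi> (Suc (i + d)) = \<pi> (i + d) @ [j]"
    by (rule tree_edge[OF assms(1)])
  then show ?case using Suc tree_path_length[OF assms, of "i + d"] by simp
qed

lemma level_eq_iff:
  assumes "fractal p n w"
  shows "level p n w i = k \<longleftrightarrow>
    (if k = 0 then \<forall>j\<in>{1..n}. i < length (w 1) \<longrightarrow> p \<notin> w j ! i
     else k \<in> {1..n} \<and> i < length (w 1) \<and> p \<in> w k ! i)"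
proof (cases "\<exists>j\<in>{1..n}. i < length (w 1) \<and> p \<in> w j ! i")
  case True
  then obtain j where j: "j \<in> {1..n}" "i < length (w 1)" "p \<in> w j ! i" by blast
  then have "level p n w i = j" by (rule fractal_level[OF assms])
  moreover have "k = j" if "k \<in> {1..n}" "p \<in> w k ! i"
    using fractal_level[OF assms that(1) j(2) that(2)] \<open>level p n w i = j\<close> by simp
  ultimately show ?thesis using j by auto
next
  case False
  then show ?thesis by (auto simp: level_def)
qed

section \<open>Paths and labels of \<open>K\<close>\<close>

locale K_structure =
  fixes p :: 'a and n l :: nat
    and \<eta> :: "nat list" and \<xi> :: "nat \<Rightarrow> nat list" and w :: "nat \<Rightarrow> 'a set list"
    and K :: "(nat list, 'a) kripke"
  assumes n: "n > 1" and K: "is_K p n l \<eta> \<xi> w K"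
begin

definition node :: "nat \<Rightarrow> nat list" where
  "node k = (if k = 0 then \<eta> else \<xi> k)"

definition path :: "nat \<Rightarrow> nat \<Rightarrow> nat list" where
  "path k = path_through K (node k)"

abbreviation c :: "nat word" where
  "c \<equiv> level p n w"

lemma tree: "tree_structure {p} K"
  using K by (simp add: is_K_def regular_tree_def)

lemma init_K: "init K = []"
  using tree by (simp add: tree_structure_def)

lemma successors: "{s. (init K, s) \<in> edges K} = node ` {0..n}"
proof -
  have "{0..n} = insert 0 {1..n}" by auto
  then have "node ` {0..n} = insert \<eta> (\<xi> ` {1..n})" by (auto simp: node_def image_iff)
  then show ?thesis using K by (simp add: is_K_def)
qed

lemma node_inj: "inj_on node {0..n}"
proof -
  have K': "inj_on \<xi> {1..n}" "\<eta> \<notin> \<xi> ` {1..n}" using K by (simp_all add: is_K_def)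
  have "inj_on node {1..n} \<longleftrightarrow> inj_on \<xi> {1..n}" by (rule inj_on_cong) (simp add: node_def)
  moreover have "node ` {1..n} = \<xi> ` {1..n}" by (rule image_cong) (simp_all add: node_def)
  moreover have "node 0 = \<eta>" by (simp add: node_def)
  moreover have "{0..n} = insert 0 {1..n}" "{1..n} - {0} = {1..n}" by auto
  ultimately show ?thesis using K' by (simp only: inj_on_insert) simp
qed

lemma ex1_path:
  assumes "k \<le> n"
  shows "\<exists>!\<pi>. initial_path K \<pi> \<and> node k \<in> range \<pi>"
proof (cases "k = 0")
  case True
  then show ?thesis using K unfolding is_K_def node_def by simp
next
  case False
  then have "k \<in> {1..n}" using assms by auto
  then show ?thesis using K False unfolding is_K_def node_def by simp
qed

lemma path:
  assumes "k \<le> n"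
  shows "initial_path K (path k)" "path k 1 = node k"
proof -
  have *: "initial_path K (path k) \<and> node k \<in> range (path k)"
    using theI'[OF ex1_path[OF assms]] by (simp add: path_def path_through_def)
  then show "initial_path K (path k)" ..
  from * obtain j where j: "node k = path k j" by auto
  have "(init K, node k) \<in> edges K" using successors assms by auto
  then have "length (node k) = 1" using init_K by (auto elim: tree_edge[OF tree])
  then have "j = 1" using j tree_path_length[OF tree] * by metis
  then show "path k 1 = node k" using j by simp
qed

lemma path_eqI:
  assumes "k \<le> n" "initial_path K \<pi>" "\<pi> 1 = node k"
  shows "\<pi> = path k"
  using ex1_path[OF assms(1)] path[OF assms(1)] assms(2,3) by (metis rangeI)

text \<open>The second node of a path is a successor of the root, and only one initial path runs
  through each of these; hence \<open>path\<close> enumerates all initial paths.\<close>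

lemma initial_path_cases:
  assumes "initial_path K \<pi>"
  obtains k where "k \<le> n" "\<pi> = path k"
proof -
  have "(init K, \<pi> 1) \<in> edges K" using assms by (metis initial_path_def One_nat_def)
  then obtain k where "k \<le> n" "\<pi> 1 = node k"
    using successors by (metis atLeastAtMost_iff imageE mem_Collect_eq)
  then show thesis using path_eqI assms that by blast
qed

text \<open>Depth determines the position and the ancestor at depth 1 determines the path.
  Relabelling a single state therefore affects one path at one position.\<close>

lemma path_state_inj:
  assumes "k \<le> n" "k' \<le> n" "path k (Suc i) = path k' (Suc j)"
  shows "k = k'" "i = j"
proof -
  show "i = j" using assms path tree_path_length[OF tree] by (metis Suc_inject)
  have "node k = node k'"
    using tree_path_take[OF tree path(1), of k 1 i] tree_path_take[OF tree path(1), of k' 1 j]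
      path(2) assms by simp
  then show "k = k'" using node_inj assms(1,2) by (auto simp: inj_on_def)
qed

lemma fractal: "fractal p n w" and len: "k \<le> n \<Longrightarrow> length (w k) = l"
  using K by (auto simp: is_K_def)

text \<open>For \<open>k = 0\<close> this holds because \<open>w 0\<close> is the dual of the whole
  join and is followed by \<open>p\<close> forever, in line with the default 0 of
  \<open>level\<close>. So each positive position carries \<open>p\<close> on exactly one
  path.\<close>

lemma val_path:
  assumes "k \<le> n"
  shows "p \<in> val K (path k (Suc i)) \<longleftrightarrow> c i = k"
proof (cases "k = 0")
  case True
  have "val K (path k (Suc i)) = trace K (path_through K \<eta>) (Suc i)"
    by (simp add: True path_def node_def trace_def)
  also have "\<dots> = (w 0 \<frown> [{p}]\<^sup>\<omega>) i" using K by (simp add: is_K_def)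
  also have "\<dots> = (if i < l then {p} - join (map w [1..<Suc n]) ! i else {p})"
  proof -
    have "w 0 = dual p (join (map w [1..<Suc n]))" using K by (simp add: is_K_def)
    moreover have "length (join (map w [1..<Suc n])) = l" using join_length[of n w] n len by simp
    ultimately show ?thesis by (simp add: conc_def dual_def)
  qed
  finally show ?thesis
    using join_nth[of n i w] n len[of 1] by (auto simp: True level_eq_iff[OF fractal])
next
  case False
  then have k: "k \<in> {1..n}" using assms by auto
  have "val K (path k (Suc i)) = trace K (path_through K (\<xi> k)) (Suc i)"
    using False by (simp add: path_def node_def trace_def)
  also have "\<dots> = (w k \<frown> [{}]\<^sup>\<omega>) i" using K k by (simp add: is_K_def)
  also have "\<dots> = (if i < l then w k ! i else {})" using assms by (simp add: conc_def len)
  finally show ?thesis using k len[of 1] by (auto simp: level_eq_iff[OF fractal])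
qed

lemma alert_positions: "{i \<in> {1..l}. val K (path_through K (\<xi> 1) i) = {p}} = Suc ` {i. c i = 1}"
proof -
  have P: "path_through K (\<xi> 1) = path 1" by (simp add: path_def node_def)
  have "val K (path 1 i) \<subseteq> {p}" for i
  proof -
    have "(path 1 i, path 1 (Suc i)) \<in> edges K" using path(1)[of 1] n by (simp add: initial_path_def)
    then show ?thesis using tree by (auto simp: tree_structure_def kripke_structure_def)
  qed
  then have "val K (path 1 i) = {p} \<longleftrightarrow> p \<in> val K (path 1 i)" for i by blast
  then have *: "val K (path 1 (Suc i)) = {p} \<longleftrightarrow> c i = 1" for i using val_path[of 1 i] n by simp
  have lt: "i < l" if "c i = 1" for i
    using that len[of 1] n by (auto simp: level_eq_iff[OF fractal])
  show ?thesis unfolding P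
  proof (intro equalityI subsetI)
    fix i assume "i \<in> {i \<in> {1..l}. val K (path 1 i) = {p}}"
    then show "i \<in> Suc ` {i. c i = 1}" using *[of "i - 1"] by (cases i) auto
  next
    fix i assume "i \<in> Suc ` {i. c i = 1}"
    then show "i \<in> {i \<in> {1..l}. val K (path 1 i) = {p}}" using * lt by fastforce
  qed
qed

lemma sat_M_iff:
  fixes \<phi> :: "('a, 'v) hyperctl"
  assumes "props \<phi> \<subseteq> {p}" "\<forall>x. initial_path K (\<Pi> x)" "card (\<Pi> ` insert y (free_vars \<phi>)) + fsize \<phi> \<le> n"
  shows "sat K \<Pi> y 0 \<phi> \<longleftrightarrow> sat (M_of p l \<xi> K) \<Pi> y 0 \<phi>"
proof -
  let ?M = "M_of p l \<xi> K"
  obtain vs where vs: "length vs = n + 4" "\<forall>v\<in>set vs. seg n 1 v"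
    "c = (concat (map ((#) 1) vs) @ [1]) \<frown> (\<lambda>_. 0)"
    using fractal_seg[OF fractal] n by auto
  obtain a where a: "sorted_list_of_set (Suc ` {i. c i = 1}) ! 2 = Suc a" "c a = 1"
    and equiv: "\<And>h (\<phi> :: ('a, 'v) hyperctl) \<rho> y. fsize \<phi> \<le> n \<Longrightarrow> h = 0 \<or> 1 < h \<and> h \<le> n \<Longrightarrow>
       wsat \<rho> y c \<phi> \<longleftrightarrow> wsat \<rho> y (c(a := h)) \<phi>"
    using alert_word[OF vs(3,1,2)] by blast
  have M: "?M = K\<lparr>val := (val K)(path 1 (Suc a) := {})\<rparr>"
    unfolding M_of_def i_alert_def alert_positions a(1) by (simp add: path_def node_def)
  have paths: "initial_path ?M \<pi> \<longleftrightarrow> initial_path K \<pi>" for \<pi>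
    by (simp add: M initial_path_def)
  have "length (path 1 (Suc a)) = Suc a" using tree_path_length[OF tree] path(1)[of 1] n by simp
  then have root: "val ?M (init K) = val K (init K)" by (auto simp: M init_K)
  have "sat K \<Pi> y 1 \<phi> \<longleftrightarrow> sat ?M \<Pi> y 1 \<phi>"
    if "props \<phi> \<subseteq> {p}" "fsize \<phi> < n" and \<Pi>: "\<forall>x. initial_path K (\<Pi> x)"
      and card: "card (\<Pi> ` insert y (free_vars \<phi>)) < n" for \<phi> :: "('a, 'v) hyperctl" and \<Pi> y
  proof -
    \<comment> \<open>The \<open>n\<close> path indices other than 1. Fewer than \<open>n\<close>
      paths are in use, so one of these indices can be chosen as the unobserved
      \<open>h\<close>.\<close>
    let ?H = "insert 0 {2..n}" and ?S = "\<Pi> ` insert y (free_vars \<phi>)"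
    have "inj_on path ?H"
      using path_state_inj(1)[of _ _ 0 0] n by (intro inj_onI) auto
    then have "card (path ` ?H) = n" using n by (simp add: card_image)
    then have "\<not> path ` ?H \<subseteq> ?S" using card card_mono[of ?S "path ` ?H"] by auto
    then obtain h where h: "h \<in> ?H" "path h \<notin> ?S" by blast
    have "\<exists>k. k \<le> n \<and> \<Pi> x = path k" for x using initial_path_cases[of "\<Pi> x"] \<Pi> by metis
    then obtain \<rho> where \<rho>: "\<And>x. \<rho> x \<le> n \<and> \<Pi> x = path (\<rho> x)" by metis
    have vars: "\<forall>x\<in>insert y (free_vars \<phi>). \<rho> x \<in> {0..n} - {h} \<and> \<Pi> x = path (\<rho> x)"
      using \<rho> h(2) by (metis Diff_iff atLeastAtMost_iff image_eqI le0 singletonD)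
    have det: "\<pi> = path k" if "k \<in> {0..n} - {h}" "initial_path K \<pi>" "\<forall>j\<le>Suc i. \<pi> j = path k j" for k \<pi> i
      using that path(2)[of k] by (intro path_eqI) auto
    have "sat K \<Pi> y (Suc 0) \<phi> \<longleftrightarrow> wsat \<rho> y (suffix 0 c) \<phi>"
      by (rule sat_wsat[where I = "{0..n} - {h}" and P = path and p = p])
        (use det path val_path that(1) vars in auto)
    also have "\<dots> \<longleftrightarrow> wsat \<rho> y (suffix 0 (c(a := h))) \<phi>"
      using equiv[of \<phi> h \<rho> y] that(2) h(1) by auto
    also have "\<dots> \<longleftrightarrow> sat ?M \<Pi> y (Suc 0) \<phi>"
    proof (rule sat_wsat[symmetric, where I = "{0..n} - {h}" and P = path and p = p])
      fix k i assume k: "k \<in> {0..n} - {h}"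
      show "p \<in> val ?M (path k (Suc i)) \<longleftrightarrow> (c(a := h)) i = k"
      \<comment> \<open>At the relabelled state the new letter \<open>h\<close> differs from 1, as
        required. Other paths did not carry \<open>p\<close> at \<open>a\<close> because
        \<open>c a = 1\<close>, and since \<open>k \<noteq> h\<close> the letter \<open>h\<close>
        does not claim it for them.\<close>
      proof (cases "k = 1 \<and> i = a")
        case True
        then show ?thesis using h(1) by (auto simp: M)
      next
        case False
        then have "path k (Suc i) \<noteq> path 1 (Suc a)" using path_state_inj[of k 1 i a] k n by auto
        then show ?thesis using val_path[of k i] k a(2) False by (auto simp: M)
      qed
    qed (use det path that(1) vars paths in auto)
    finally show ?thesis by simp
  qed
  then show ?thesis by (rule sat_transfer[OF paths root _ assms])
qed

end

theorem theorem4: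
  fixes p :: 'a and n l :: nat
    and \<eta> :: "nat list" and \<xi> :: "nat \<Rightarrow> nat list" and w :: "nat \<Rightarrow> 'a set list"
    and K M :: "(nat list, 'a) kripke"
    and \<psi> :: "('a, 'v) hyperctl"
  assumes "n > 1"
    and "is_K p n l \<eta> \<xi> w K"
    and "M = M_of p l \<xi> K"
    and "sentence \<psi>" and "props \<psi> \<subseteq> {p}"
    and "fsize \<psi> < n"
  shows "K \<Turnstile> \<psi> \<longleftrightarrow> M \<Turnstile> \<psi>"
proof -
  interpret K_structure p n l \<eta> \<xi> w K using assms by unfold_locales
  \<comment> \<open>Without free variables only the path of \<open>y\<close> is in use, so the total
    to be bounded by \<open>n\<close> is \<open>1 + fsize \<psi>\<close>.\<close>
  have "sat K \<Pi> y 0 \<psi> \<longleftrightarrow> sat M \<Pi> y 0 \<psi>" if "\<forall>x. initial_path K (\<Pi> x)" for \<Pi> y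
    using sat_M_iff[of \<psi> \<Pi> y] that assms(3-6) by (simp add: sentence_def)
  moreover have "initial_path M \<pi> \<longleftrightarrow> initial_path K \<pi>" for \<pi>
    by (simp add: assms(3) M_of_def initial_path_def)
  ultimately show ?thesis by (auto simp: models_def)
qed

end
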